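(* Let $(T_1,T_2)$ be a pair of commuting operators on a complex Hilbert space $\mathcal{H}$. If the map $T:\mathbb{Z}\oplus\mathbb{Z}\to\mathcal{B}(\mathcal{H})$ given by $$T(m,n)=\begin{cases} T_1^mT_2^n & m\ge 0,\ n\ge 0\\ T_1^{*|m|}T_2^n & m<0,\ n\ge 0\\ T_2^{*|n|}T_1^m & m\ge 0,\ n<0\\ T_1^{*|m|}T_2^{*|n|} & m<0,\ n<0\end{cases}$$ is positive definite, then $(T_1,T_2)$ satisfies Brehmer positivity, i.e. $T_1,T_2$ are contractions and $$I_{\mathcal{H}}-T_1^*T_1-T_2^*T_2+(T_1T_2)^*T_1T_2\ge 0 .$$
   Context: All operators are bounded and linear; $\mathcal{B}(\mathcal{H})$ is the algebra of bounded operators on $\mathcal{H}$. A contraction is an operator of norm at most one. Zeroth powers are the identity. For a group $G$, a map $T:G\to\mathcal{B}(\mathcal{H})$ is positive definite if $T(s^{-1})=T(s)^*$ for every $s\in G$ and $\sum_{s\in G}\sum_{t\in G}\langle T(t^{-1}s)h(s),h(t)\rangle\ge 0$ for every finitely supported function $h:G\to\mathcal{H}$. *)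

theory Defs
  imports "HOL-Analysis.Analysis"
begin

section \<open>Complex Hilbert spaces\<close>

text \<open>The inner product is linear in its first argument and conjugate-linear in the second.\<close>

class complex_inner = real_normed_vector +
  fixes scaleC :: "complex \<Rightarrow> 'a \<Rightarrow> 'a"  (infixr "*\<^sub>C" 75)
    and cinner :: "'a \<Rightarrow> 'a \<Rightarrow> complex"
  assumes scaleC_add_right: "a *\<^sub>C (x + y) = a *\<^sub>C x + a *\<^sub>C y"
    and scaleC_add_left: "(a + b) *\<^sub>C x = a *\<^sub>C x + b *\<^sub>C x"
    and scaleC_scaleC: "a *\<^sub>C (b *\<^sub>C x) = (a * b) *\<^sub>C x"
    and scaleR_scaleC: "r *\<^sub>R x = complex_of_real r *\<^sub>C x"
    and cinner_commute: "cinner x y = cnj (cinner y x)"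
    and cinner_add_left: "cinner (x + y) z = cinner x z + cinner y z"
    and cinner_scaleC_left: "cinner (a *\<^sub>C x) y = a * cinner x y"
    and cinner_self: "cinner x x = complex_of_real ((norm x)\<^sup>2)"

class chilbert_space = complex_inner + complete_space

instantiation complex :: chilbert_space
begin

definition scaleC_complex :: "complex \<Rightarrow> complex \<Rightarrow> complex"
  where "scaleC_complex a x = a * x"

definition cinner_complex :: "complex \<Rightarrow> complex \<Rightarrow> complex"
  where "cinner_complex x y = x * cnj y"

instance
  by standard
    (simp_all add: scaleC_complex_def cinner_complex_def algebra_simps scaleR_conv_of_real
      complex_norm_square del: of_real_power)

end


section \<open>Bounded operators\<close>

definition bounded_clinear :: "('a::complex_inner \<Rightarrow> 'a) \<Rightarrow> bool"
  where "bounded_clinear f \<longleftrightarrow> bounded_linear f \<and> (\<forall>c x. f (c *\<^sub>C x) = c *\<^sub>C f x)"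

lemma scaleC_zero_right [simp]: "c *\<^sub>C (0::'a::complex_inner) = 0"
  using scaleC_add_right[of c "0::'a" 0] by simp

lemma scaleC_minus_right [simp]: "c *\<^sub>C (- x) = - (c *\<^sub>C (x::'a::complex_inner))"
  using scaleC_add_right[of c x "- x"] by (simp add: eq_neg_iff_add_eq_0 add.commute)

lemma scaleC_diff_right: "c *\<^sub>C (x - y) = c *\<^sub>C x - c *\<^sub>C (y::'a::complex_inner)"
  using scaleC_add_right[of c x "- y"] by simp

typedef (overloaded) 'a bop = "{f :: 'a::complex_inner \<Rightarrow> 'a. bounded_clinear f}"
  morphisms bop_apply Abs_bop
  by (rule exI[of _ "\<lambda>_. 0"]) (simp add: bounded_clinear_def)

setup_lifting type_definition_bop

text \<open>Addition is pointwise and multiplication is composition, so that \<open>T ^ n\<close> is the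
  \<open>n\<close>-fold composition of \<open>T\<close>.  The class \<open>ring_1\<close> is not available because the space may be
  zero-dimensional.\<close>

instantiation bop :: (complex_inner) "{ring, monoid_mult}"
begin

lift_definition zero_bop :: "'a bop" is "\<lambda>_. 0"
  by (simp add: bounded_clinear_def)

lift_definition one_bop :: "'a bop" is "\<lambda>x. x"
  by (simp add: bounded_clinear_def)

lift_definition plus_bop :: "'a bop \<Rightarrow> 'a bop \<Rightarrow> 'a bop" is "\<lambda>S T x. S x + T x"
  by (simp add: bounded_clinear_def bounded_linear_add scaleC_add_right)

lift_definition uminus_bop :: "'a bop \<Rightarrow> 'a bop" is "\<lambda>T x. - T x"
  by (simp add: bounded_clinear_def bounded_linear_minus)

lift_definition minus_bop :: "'a bop \<Rightarrow> 'a bop \<Rightarrow> 'a bop" is "\<lambda>S T x. S x - T x"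
  by (simp add: bounded_clinear_def bounded_linear_sub scaleC_diff_right)

lift_definition times_bop :: "'a bop \<Rightarrow> 'a bop \<Rightarrow> 'a bop" is "\<lambda>S T x. S (T x)"
  by (simp add: bounded_clinear_def bounded_linear_compose)

instance
  by standard
    (transfer; simp add: fun_eq_iff bounded_clinear_def linear_simps algebra_simps)+

end

text \<open>The Hilbert space adjoint; on a \<open>chilbert_space\<close> it exists and is unique by the
  Riesz representation theorem.\<close>

definition adj :: "'a::chilbert_space bop \<Rightarrow> 'a bop"
  where "adj T = (THE S. \<forall>x y. cinner (bop_apply S x) y = cinner x (bop_apply T y))"

definition contraction :: "'a::chilbert_space bop \<Rightarrow> bool"
  where "contraction T \<longleftrightarrow> onorm (bop_apply T) \<le> 1"

definition positive_op :: "'a::chilbert_space bop \<Rightarrow> bool"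
  where "positive_op A \<longleftrightarrow> (\<forall>x. cinner (bop_apply A x) x \<in> \<real>\<^sub>\<ge>\<^sub>0)"


section \<open>Positive definite maps and Brehmer positivity\<close>

text \<open>The class \<open>group_add\<close> is that of arbitrary (not necessarily abelian) groups, written
  additively: \<open>- t + s\<close> stands for $t^{-1}s$.\<close>

definition positive_definite :: "('g::group_add \<Rightarrow> 'a::chilbert_space bop) \<Rightarrow> bool"
  where "positive_definite T \<longleftrightarrow>
    (\<forall>s. T (- s) = adj (T s)) \<and>
    (\<forall>h :: 'g \<Rightarrow> 'a. finite {s. h s \<noteq> 0} \<longrightarrow>
      (\<Sum>s | h s \<noteq> 0. \<Sum>t | h t \<noteq> 0. cinner (bop_apply (T (- t + s)) (h s)) (h t)) \<in> \<real>\<^sub>\<ge>\<^sub>0)"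

definition pair_map :: "'a::chilbert_space bop \<Rightarrow> 'a bop \<Rightarrow> int \<times> int \<Rightarrow> 'a bop"
  where "pair_map T1 T2 = (\<lambda>(m, n).
    if m \<ge> 0 \<and> n \<ge> 0 then T1 ^ nat m * T2 ^ nat n
    else if m < 0 \<and> n \<ge> 0 then adj T1 ^ nat \<bar>m\<bar> * T2 ^ nat n
    else if m \<ge> 0 \<and> n < 0 then adj T2 ^ nat \<bar>n\<bar> * T1 ^ nat m
    else adj T1 ^ nat \<bar>m\<bar> * adj T2 ^ nat \<bar>n\<bar>)"

definition brehmer_positive :: "'a::chilbert_space bop \<Rightarrow> 'a bop \<Rightarrow> bool"
  where "brehmer_positive T1 T2 \<longleftrightarrow> contraction T1 \<and> contraction T2 \<and>
    positive_op (1 - adj T1 * T1 - adj T2 * T2 + adj (T1 * T2) * (T1 * T2))"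

end

theory Submission
  imports Defs
begin

text \<open>Positive definiteness is tested on functions supported on \<open>{0,1}\<times>{0,1}\<close>.  The values
  \<open>h(1,1) = x\<close>, \<open>h(1,0) = -T\<^sub>2 x\<close>, \<open>h(0,1) = -T\<^sub>1 x\<close>, \<open>h(0,0) = T\<^sub>1 T\<^sub>2 x\<close> make the quadratic form
  equal to the value of the Brehmer operator at \<open>x\<close>; here commutativity is used.  The values
  \<open>h(1,0) = x\<close>, \<open>h(0,0) = -T\<^sub>1 x\<close> give \<open>\<parallel>x\<parallel>\<^sup>2 - \<parallel>T\<^sub>1 x\<parallel>\<^sup>2\<close>, whence \<open>T\<^sub>1\<close> is a contraction, and
  likewise for \<open>T\<^sub>2\<close>.  Both computations need the existence of adjoints, which rests on the Riesz
  representation theorem: the representing vector of \<open>f\<close> minimises \<open>\<parallel>x\<parallel>\<^sup>2 - 2 Re (f x)\<close>.\<close>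

section \<open>Complex inner products\<close>

lemma cinner_add_right: "cinner x (y + z) = cinner x y + cinner x z"
  by (metis cinner_commute cinner_add_left complex_cnj_add)

lemma cinner_scaleC_right: "cinner x (a *\<^sub>C y) = cnj a * cinner x y"
  by (metis cinner_commute cinner_scaleC_left complex_cnj_mult)

lemma cinner_zero_left [simp]: "cinner 0 x = 0"
  using cinner_add_left[of 0 0 x] by simp

lemma cinner_zero_right [simp]: "cinner x 0 = 0"
  using cinner_add_right[of x 0 0] by simp

lemma cinner_minus_left [simp]: "cinner (- x) y = - cinner x y"
  using cinner_add_left[of x "- x" y] by (simp add: add_eq_0_iff)

lemma cinner_minus_right [simp]: "cinner x (- y) = - cinner x y"
  using cinner_add_right[of x y "- y"] by (simp add: add_eq_0_iff)

lemma cinner_diff_left: "cinner (x - y) z = cinner x z - cinner y z"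
  using cinner_add_left[of x "- y" z] by simp

lemma cinner_diff_right: "cinner x (y - z) = cinner x y - cinner x z"
  using cinner_add_right[of x y "- z"] by simp

lemma Re_cinner_self: "Re (cinner x x) = (norm x)\<^sup>2"
  by (simp add: cinner_self)

lemma Re_cinner_commute: "Re (cinner x y) = Re (cinner y x)"
  by (subst cinner_commute) simp

lemma norm_add_power2: "(norm (x + y))\<^sup>2 = (norm x)\<^sup>2 + 2 * Re (cinner x y) + (norm y)\<^sup>2"
  using Re_cinner_commute[of y x]
  by (simp add: Re_cinner_self[symmetric] cinner_add_left cinner_add_right)

lemma norm_diff_power2: "(norm (x - y))\<^sup>2 = (norm x)\<^sup>2 - 2 * Re (cinner x y) + (norm y)\<^sup>2"
  using Re_cinner_commute[of y x]
  by (simp add: Re_cinner_self[symmetric] cinner_diff_left cinner_diff_right)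

text \<open>The norm is only known to be homogeneous for real scalars; the complex case comes from
  pulling both scalars out of the inner product.\<close>

lemma norm_scaleC: "norm (a *\<^sub>C x) = cmod a * norm x"
proof -
  have "complex_of_real ((norm (a *\<^sub>C x))\<^sup>2) = (a * cnj a) * cinner x x"
    by (simp add: cinner_self[symmetric] cinner_scaleC_left cinner_scaleC_right del: of_real_power)
  also have "\<dots> = complex_of_real ((cmod a)\<^sup>2 * (norm x)\<^sup>2)"
    by (simp only: cinner_self complex_norm_square of_real_mult)
  finally show ?thesis
    by (simp only: of_real_eq_iff power_mult_distrib[symmetric]) (simp add: power2_eq_iff_nonneg)
qed

lemma cinner_eqI:
  assumes "\<And>z. cinner z x = cinner z y"
  shows "x = y"
proof -
  have "cinner (x - y) (x - y) = 0"
    using assms by (simp add: cinner_diff_right)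
  then show ?thesis
    by (simp add: cinner_self)
qed

text \<open>The real part of Cauchy-Schwarz, obtained by squaring the triangle inequality that the
  norm already satisfies.\<close>

lemma Re_cinner_le: "Re (cinner x y) \<le> norm x * norm y"
proof -
  have "(norm (x + y))\<^sup>2 \<le> (norm x + norm y)\<^sup>2"
    by (intro power_mono norm_triangle_ineq norm_ge_zero)
  then show ?thesis
    by (simp add: norm_add_power2 power2_sum)
qed

text \<open>Multiplying \<open>x\<close> by a unimodular \<open>c\<close> makes the inner product
  real and nonnegative, so the bound on real parts suffices.\<close>

lemma cmod_cinner_le: "cmod (cinner x y) \<le> norm x * norm y"
proof (cases "cinner x y = 0")
  case False
  define c where "c = cnj (sgn (cinner x y))"
  have c: "cmod c = 1"
    using False by (simp add: c_def norm_sgn)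
  have "cmod (cinner x y) = Re (c * cinner x y)"
    using False
    by (simp add: c_def sgn_eq complex_eq_iff cmod_def power2_eq_square add_divide_distrib [symmetric]
        real_div_sqrt)
  also have "\<dots> = Re (cinner (c *\<^sub>C x) y)"
    by (simp add: cinner_scaleC_left)
  also have "\<dots> \<le> norm x * norm y"
    using Re_cinner_le[of "c *\<^sub>C x" y] c by (simp add: norm_scaleC)
  finally show ?thesis .
qed simp

section \<open>Riesz representation and adjoints\<close>

theorem riesz_representation:
  fixes f :: "'a::chilbert_space \<Rightarrow> complex"
  assumes f: "bounded_linear f" and fC: "\<And>c x. f (c *\<^sub>C x) = c * f x"
  obtains y where "\<And>x. f x = cinner x y"
proof -
  interpret bounded_linear f by fact
  define q where "q x = (norm x)\<^sup>2 - 2 * Re (f x)" for x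
  obtain K where K: "\<And>x. norm (f x) \<le> norm x * K"
    using bounded by blast
  have "q x \<ge> - (K\<^sup>2)" for x
  proof -
    have "Re (f x) \<le> norm x * K"
      using complex_Re_le_cmod[of "f x"] K[of x] by linarith
    moreover have "0 \<le> (norm x - K)\<^sup>2"
      by simp
    ultimately show ?thesis
      by (simp add: q_def power2_diff)
  qed
  then have bdd: "bdd_below (range q)"
    by (intro bdd_belowI[of _ "- (K\<^sup>2)"]) auto
  define m where "m = (INF x. q x)"
  have m_le: "m \<le> q x" for x
    unfolding m_def using bdd by (rule cINF_lower) simp
  have "\<exists>x. q x < m + 1 / real (Suc n)" for n
    using cINF_less_iff[of UNIV q "m + 1 / real (Suc n)"] bdd by (auto simp: m_def)
  then obtain X where X: "\<And>n. q (X n) < m + 1 / real (Suc n)"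
    by metis
  \<comment> \<open>Parallelogram law: the linear terms of \<open>q\<close> at \<open>x\<close> and
    \<open>y\<close> match those at the midpoint, where \<open>q\<close> is at least
    \<open>m\<close>. Hence near-minimisers lie close together.\<close>
  have parallelogram: "(norm (x - y))\<^sup>2 \<le> 2 * (q x - m) + 2 * (q y - m)" for x y
  proof -
    have "4 * q ((1/2) *\<^sub>R (x + y)) = (norm (x + y))\<^sup>2 - 4 * Re (f x) - 4 * Re (f y)"
      by (simp add: q_def scaleR add power_divide diff_divide_distrib add_divide_distrib)
    moreover have "m \<le> q ((1/2) *\<^sub>R (x + y))"
      by (rule m_le)
    ultimately show ?thesis
      by (simp add: q_def norm_add_power2 norm_diff_power2)
  qed
  have "Cauchy X"
  proof (rule metric_CauchyI)
    fix e :: real assume "e > 0"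
    then obtain N where N: "1 / real (Suc N) < e\<^sup>2 / 4"
      using reals_Archimedean[of "e\<^sup>2 / 4"] by (auto simp: inverse_eq_divide)
    have near: "q (X i) - m < e\<^sup>2 / 4" if "i \<ge> N" for i
    proof -
      have "1 / real (Suc i) \<le> 1 / real (Suc N)"
        using that by (simp add: frac_le)
      then have "1 / real (Suc i) < e\<^sup>2 / 4"
        using N by (rule le_less_trans)
      moreover have "q (X i) - m < 1 / real (Suc i)"
        using X[of i] by (simp only: less_diff_eq diff_less_eq add.commute)
      ultimately show ?thesis
        by (rule less_trans[rotated])
    qed
    have "dist (X i) (X j) < e" if "i \<ge> N" "j \<ge> N" for i j
    proof -
      have "(norm (X i - X j))\<^sup>2 < e\<^sup>2"
        using parallelogram[of "X i" "X j"] near[OF that(1)] near[OF that(2)] by argo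
      then show ?thesis
        using \<open>e > 0\<close> by (simp add: dist_norm power_less_imp_less_base)
    qed
    then show "\<exists>N. \<forall>i\<ge>N. \<forall>j\<ge>N. dist (X i) (X j) < e"
      by blast
  qed
  then obtain y where y: "X \<longlonglongrightarrow> y"
    using Cauchy_convergent convergent_def by blast
  have "(\<lambda>n. q (X n)) \<longlonglongrightarrow> q y"
    unfolding q_def by (intro tendsto_intros y tendsto)
  moreover have "(\<lambda>n. m + 1 / real (Suc n)) \<longlonglongrightarrow> m + 0"
    using LIMSEQ_inverse_real_of_nat by (intro tendsto_intros) (simp add: inverse_eq_divide)
  ultimately have "q y \<le> m + 0"
    by (rule LIMSEQ_le) (use X in \<open>auto intro: less_imp_le\<close>)
  then have min: "q y \<le> q x" for x
    using m_le[of x] by linarith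
  have Re: "Re (f z) = Re (cinner z y)" for z
  proof -
    define d where "d = Re (f z) - Re (cinner z y)"
    \<comment> \<open>First variation: the right-hand side is
      \<open>q (y + t *\<^sub>R z) - q y\<close>.\<close>
    have quad: "0 \<le> t\<^sup>2 * (norm z)\<^sup>2 - 2 * t * d" for t
    proof -
      have "Re (cinner y (t *\<^sub>R z)) = t * Re (cinner z y)"
        by (subst Re_cinner_commute) (simp add: scaleR_scaleC cinner_scaleC_left)
      then show ?thesis
        using min[of "y + t *\<^sub>R z"]
        by (simp add: q_def d_def norm_add_power2 add scaleR power_mult_distrib algebra_simps)
    qed
    have "0 \<le> - (d\<^sup>2)"
    proof -
      \<comment> \<open>This \<open>t\<close> nearly minimises the quadratic; the \<open>+ 1\<close>
        keeps the denominator positive when \<open>z = 0\<close>.\<close>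
      have "0 \<le> (d / ((norm z)\<^sup>2 + 1))\<^sup>2 * (norm z)\<^sup>2 - 2 * (d / ((norm z)\<^sup>2 + 1)) * d"
        by (rule quad)
      also have "\<dots> \<le> (d / ((norm z)\<^sup>2 + 1))\<^sup>2 * ((norm z)\<^sup>2 + 1) - 2 * (d / ((norm z)\<^sup>2 + 1)) * d"
        by (intro diff_right_mono mult_left_mono) auto
      also have "\<dots> = - (d\<^sup>2) / ((norm z)\<^sup>2 + 1)"
        by (simp add: power2_eq_square divide_simps)
      finally show ?thesis
        using zero_le_power2[of "norm z"] by (subst (asm) zero_le_divide_iff) linarith
    qed
    then show ?thesis
      by (simp add: d_def)
  qed
  have "f z = cinner z y" for z
    \<comment> \<open>Complex linearity turns the real part at \<open>\<i> *\<^sub>C z\<close> into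
      minus the imaginary part at \<open>z\<close>.\<close>
    using Re[of z] Re[of "\<i> *\<^sub>C z"] by (simp add: fC cinner_scaleC_left complex_eq_iff)
  then show thesis
    by (rule that)
qed

lemma bounded_linear_bop_apply: "bounded_linear (bop_apply T)"
  using bop_apply[of T] by (simp add: bounded_clinear_def)

lemma bop_apply_scaleC: "bop_apply T (c *\<^sub>C x) = c *\<^sub>C bop_apply T x"
  using bop_apply[of T] by (simp add: bounded_clinear_def)

lemma bop_apply_simps [simp]:
  "bop_apply 1 x = x"
  "bop_apply (S + T) x = bop_apply S x + bop_apply T x"
  "bop_apply (S - T) x = bop_apply S x - bop_apply T x"
  "bop_apply (S * T) x = bop_apply S (bop_apply T x)"
  by (simp_all add: one_bop.rep_eq plus_bop.rep_eq minus_bop.rep_eq times_bop.rep_eq)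

lemma bop_apply_minus [simp]: "bop_apply T (- x) = - bop_apply T x"
  using bounded_linear_bop_apply by (rule linear_simps(4))

text \<open>Riesz represents \<open>y\<close> \<mapsto> \<open>cinner (bop_apply T y) x\<close> by a
  vector \<open>S x\<close>. Uniqueness of that vector makes \<open>S\<close> linear, and pairing
  \<open>S x\<close> with itself transfers the bound \<open>K\<close> from \<open>T\<close>.\<close>

lemma adjoint_exists:
  fixes T :: "'a::chilbert_space bop"
  shows "\<exists>S. \<forall>x y. cinner (bop_apply S x) y = cinner x (bop_apply T y)"
proof -
  interpret T: bounded_linear "bop_apply T"
    by (rule bounded_linear_bop_apply)
  obtain K where K: "\<And>x. norm (bop_apply T x) \<le> norm x * K" "K \<ge> 0"
    using T.nonneg_bounded by blast
  have "\<exists>s. \<forall>y. cinner (bop_apply T y) x = cinner y s" for x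
  proof -
    have "norm (cinner (bop_apply T y) x) \<le> norm y * (K * norm x)" for y
      using cmod_cinner_le[of "bop_apply T y" x] mult_right_mono[OF K(1)[of y] norm_ge_zero[of x]]
      by (simp add: mult.assoc)
    then have "bounded_linear (\<lambda>y. cinner (bop_apply T y) x)"
      by (intro bounded_linear_intro)
        (simp_all add: T.add T.scaleR cinner_add_left scaleR_scaleC[where 'a='a]
          bop_apply_scaleC cinner_scaleC_left scaleR_conv_of_real)
    moreover have "cinner (bop_apply T (c *\<^sub>C y)) x = c * cinner (bop_apply T y) x" for c y
      by (simp add: bop_apply_scaleC cinner_scaleC_left)
    ultimately obtain s where "\<And>y. cinner (bop_apply T y) x = cinner y s"
      by (rule riesz_representation) (assumption | blast)+
    then show ?thesis
      by blast
  qed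
  then obtain S where S: "\<And>x y. cinner (bop_apply T y) x = cinner y (S x)"
    by metis
  have add: "S (x + y) = S x + S y" for x y
    by (rule cinner_eqI) (simp add: S[symmetric] cinner_add_right)
  have scale: "S (c *\<^sub>C x) = c *\<^sub>C S x" for c x
    by (rule cinner_eqI) (simp add: S[symmetric] cinner_scaleC_right)
  have "norm (S x) \<le> norm x * K" for x
  proof (cases "S x = 0")
    case False
    have "norm (S x) * norm (S x) = Re (cinner (bop_apply T (S x)) x)"
      by (simp add: S Re_cinner_self power2_eq_square)
    also have "\<dots> \<le> norm (bop_apply T (S x)) * norm x"
      by (rule Re_cinner_le)
    also have "\<dots> \<le> norm (S x) * K * norm x"
      by (intro mult_right_mono K norm_ge_zero)
    finally show ?thesis
      using False by (simp add: mult.assoc mult.commute)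
  qed (use K in simp)
  then have "bounded_clinear S"
    unfolding bounded_clinear_def
    by (auto intro!: bounded_linear_intro simp: add scale scaleR_scaleC)
  then have "bop_apply (Abs_bop S) = S"
    by (simp add: Abs_bop_inverse)
  then have "cinner (bop_apply (Abs_bop S) x) y = cinner x (bop_apply T y)" for x y
    using S[of y x] by (metis cinner_commute)
  then show ?thesis
    by blast
qed

text \<open>Existence and uniqueness justify the description in \<open>adj\<close>. As a simp rule
  this removes adjoints from the quadratic forms below.\<close>

lemma cinner_adj_left [simp]: "cinner (bop_apply (adj T) x) y = cinner x (bop_apply T y)"
proof -
  have "\<exists>!S. \<forall>x y. cinner (bop_apply S x) y = cinner x (bop_apply T y)"
  proof (rule ex_ex1I)
    fix S S'
    assume "\<forall>x y. cinner (bop_apply S x) y = cinner x (bop_apply T y)"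
      and "\<forall>x y. cinner (bop_apply S' x) y = cinner x (bop_apply T y)"
    then have "bop_apply S x = bop_apply S' x" for x
      by (metis cinner_commute cinner_eqI)
    then show "S = S'"
      by (simp add: bop_apply_inject[symmetric] fun_eq_iff)
  qed (rule adjoint_exists)
  from theI'[OF this] show ?thesis
    unfolding adj_def by blast
qed

section \<open>Positive definite maps\<close>

text \<open>Frees test functions from the exact support: \<open>h\<close> may vanish inside
  \<open>A\<close> and is arbitrary outside, since cutting it off to \<open>A\<close> changes only
  zero terms.\<close>

lemma positive_definite_sum:
  assumes T: "positive_definite T" and A: "finite A"
  shows "(\<Sum>s\<in>A. \<Sum>t\<in>A. cinner (bop_apply (T (- t + s)) (h s)) (h t)) \<in> \<real>\<^sub>\<ge>\<^sub>0"
proof -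
  define g where "g s = (if s \<in> A then h s else 0)" for s
  have sub: "{s. g s \<noteq> 0} \<subseteq> A"
    by (auto simp: g_def)
  have zero: "bop_apply S 0 = 0" for S :: "'b bop"
    using bounded_linear_bop_apply by (rule linear_simps(3))
  have "(\<Sum>s\<in>A. \<Sum>t\<in>A. cinner (bop_apply (T (- t + s)) (h s)) (h t))
      = (\<Sum>s\<in>A. \<Sum>t\<in>A. cinner (bop_apply (T (- t + s)) (g s)) (g t))"
    by (simp add: g_def)
  also have "\<dots> = (\<Sum>s | g s \<noteq> 0. \<Sum>t | g t \<noteq> 0. cinner (bop_apply (T (- t + s)) (g s)) (g t))"
    by (intro sum.mono_neutral_cong_right A sub sum.mono_neutral_right) (auto simp: zero)
  also have "\<dots> \<in> \<real>\<^sub>\<ge>\<^sub>0"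
    using T finite_subset[OF sub A] by (simp add: positive_definite_def)
  finally show ?thesis .
qed

text \<open>On the points \<open>0\<close> and \<open>s\<close>, the two cross terms each contribute
  minus the squared norm of \<open>T s\<close> at \<open>x\<close>, and the diagonal returns it
  once.\<close>

lemma contraction_if_positive_definite:
  assumes T: "positive_definite T" and "T 0 = 1" and "s \<noteq> 0"
  shows "contraction (T s)"
proof -
  have "norm (bop_apply (T s) x) \<le> 1 * norm x" for x
  proof -
    define h where "h t = (if t = s then x else - bop_apply (T s) x)" for t
    have "T (- s) = adj (T s)"
      using T by (simp add: positive_definite_def)
    then have "(\<Sum>u\<in>{0, s}. \<Sum>t\<in>{0, s}. cinner (bop_apply (T (- t + u)) (h u)) (h t))
        = cinner x x - cinner (bop_apply (T s) x) (bop_apply (T s) x)"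
      using \<open>s \<noteq> 0\<close> \<open>T 0 = 1\<close> by (simp add: h_def)
    moreover have "(\<Sum>u\<in>{0, s}. \<Sum>t\<in>{0, s}. cinner (bop_apply (T (- t + u)) (h u)) (h t)) \<in> \<real>\<^sub>\<ge>\<^sub>0"
      by (rule positive_definite_sum[OF T]) simp
    ultimately have "(norm (bop_apply (T s) x))\<^sup>2 \<le> (norm x)\<^sup>2"
      by (simp add: complex_nonneg_Reals_iff Re_cinner_self)
    then show ?thesis
      by (simp add: power2_le_iff_abs_le)
  qed
  then show ?thesis
    unfolding contraction_def by (rule onorm_bound[OF zero_le_one])
qed

theorem proposition4p7:
  fixes T1 T2 :: "'a::chilbert_space bop"
  assumes "T1 * T2 = T2 * T1"
    and "positive_definite (pair_map T1 T2)"
  shows "brehmer_positive T1 T2"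
proof -
  have "contraction (pair_map T1 T2 (1, 0))" "contraction (pair_map T1 T2 (0, 1))"
    by (rule contraction_if_positive_definite[OF assms(2)];
        simp add: pair_map_def zero_prod_def)+
  then have "contraction T1" "contraction T2"
    by (simp_all add: pair_map_def)
  moreover have "cinner (bop_apply (1 - adj T1 * T1 - adj T2 * T2 + adj (T1 * T2) * (T1 * T2)) x) x
      \<in> \<real>\<^sub>\<ge>\<^sub>0" for x
  proof -
    define A :: "(int \<times> int) set" where "A = {(0, 0), (1, 0), (0, 1), (1, 1)}"
    define h where "h s =
      (if s = (1, 1) then x
       else if s = (1, 0) then - bop_apply T2 x
       else if s = (0, 1) then - bop_apply T1 x
       else bop_apply T1 (bop_apply T2 x))" for s :: "int \<times> int"
    have comm: "bop_apply T2 (bop_apply T1 z) = bop_apply T1 (bop_apply T2 z)" for z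
      using arg_cong[OF assms(1), of "\<lambda>S. bop_apply S z"] by simp
    \<comment> \<open>The choice of \<open>h\<close> makes the sum over \<open>s\<close> of
      \<open>pair_map T1 T2 (- t + s)\<close> applied to \<open>h s\<close> vanish for every
      \<open>t\<close> in \<open>A\<close> except \<open>(1, 1)\<close>, where it is the Brehmer
      operator applied to \<open>x\<close>.\<close>
    have "(\<Sum>s\<in>A. \<Sum>t\<in>A. cinner (bop_apply (pair_map T1 T2 (- t + s)) (h s)) (h t))
        = cinner (bop_apply (1 - adj T1 * T1 - adj T2 * T2 + adj (T1 * T2) * (T1 * T2)) x) x"
      by (simp add: A_def h_def pair_map_def zero_prod_def comm cinner_add_left cinner_diff_left)
    moreover have "(\<Sum>s\<in>A. \<Sum>t\<in>A. cinner (bop_apply (pair_map T1 T2 (- t + s)) (h s)) (h t)) \<in> \<real>\<^sub>\<ge>\<^sub>0"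
      by (rule positive_definite_sum[OF assms(2)]) (simp add: A_def)
    ultimately show ?thesis
      by simp
  qed
  ultimately show ?thesis
    by (simp add: brehmer_positive_def positive_op_def)
qed

end
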